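(* Let $G$ be a connected graph on $n$ vertices with $\mathrm{diam}(G)\le 2$. Then for every positive integer $k$, $\pi_k(G)\le n+7k-6$.
   Context: A configuration on a graph $G$ is a function $C:V(G)\to\mathbb{Z}_{\ge 0}$ (number of pebbles on each vertex), of size $|C|=\sum_v C(v)$. A pebbling move takes two pebbles off a vertex and places one pebble on a neighboring vertex. For a root vertex $r$, a configuration is $k$-fold $r$-solvable if some sequence of pebbling moves results in at least $k$ pebbles on $r$. $\pi_k(G,r)$ is the smallest positive integer $m$ such that every configuration of size $m$ is $k$-fold $r$-solvable, and the $k$-pebbling number is $\pi_k(G)=\max_{r\in V(G)}\pi_k(G,r)$. *)

theory Defs
  imports "Graph_Theory.Graph_Theory"
begin

text \<open>
  A finite simple undirected graph is a symmetric digraph satisfying the locale predicate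
  \<^verbatim>\<open>Digraph.graph\<close>. With every arc of cost 1, \<^verbatim>\<open>wf_digraph.\<mu>\<close> is the least number of arcs
  on a walk, i.e. the usual graph distance (\<open>\<infinity>\<close> if there is no walk).
\<close>

definition graph_distance :: "('a, 'b) pre_digraph \<Rightarrow> 'a \<Rightarrow> 'a \<Rightarrow> ereal" where
  "graph_distance G u v = wf_digraph.\<mu> G (\<lambda>_. 1) u v"

definition graph_diameter :: "('a, 'b) pre_digraph \<Rightarrow> ereal" where
  "graph_diameter G = (SUP (u, v) \<in> verts G \<times> verts G. graph_distance G u v)"

text \<open>
  Configurations are total functions on the vertex type. Values outside \<open>verts G\<close> are
  irrelevant: they do not count towards the size, and moves only go along arcs.
\<close>

type_synonym 'a configuration = "'a \<Rightarrow> nat"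

definition config_size :: "('a, 'b) pre_digraph \<Rightarrow> 'a configuration \<Rightarrow> nat" where
  "config_size G C = (\<Sum>v \<in> verts G. C v)"

text \<open>The update below is the intended one because \<open>u \<noteq> v\<close> in a loop-free graph.\<close>

inductive pebbling_move ::
    "('a, 'b) pre_digraph \<Rightarrow> 'a configuration \<Rightarrow> 'a configuration \<Rightarrow> bool" for G where
  "u \<rightarrow>\<^bsub>G\<^esub> v \<Longrightarrow> 2 \<le> C u \<Longrightarrow> pebbling_move G C (C(u := C u - 2, v := C v + 1))"

definition solvable :: "('a, 'b) pre_digraph \<Rightarrow> nat \<Rightarrow> 'a \<Rightarrow> 'a configuration \<Rightarrow> bool" where
  "solvable G k r C \<longleftrightarrow> (\<exists>D. (pebbling_move G)\<^sup>*\<^sup>* C D \<and> k \<le> D r)"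

definition rooted_pebbling_number :: "('a, 'b) pre_digraph \<Rightarrow> nat \<Rightarrow> 'a \<Rightarrow> nat" where
  "rooted_pebbling_number G k r =
    (LEAST m. 0 < m \<and> (\<forall>C. config_size G C = m \<longrightarrow> solvable G k r C))"

definition pebbling_number :: "('a, 'b) pre_digraph \<Rightarrow> nat \<Rightarrow> nat" where
  "pebbling_number G k = Max (rooted_pebbling_number G k ` verts G)"

end

theory Submission
  imports Defs
begin

text \<open>
  A configuration with at least \<open>n + 1\<close> pebbles always contains at most seven pebbles that
  can bring one pebble to the root \<open>r\<close>; setting these aside and repeating gives \<open>k\<close> pebbles.
  Suppose that no seven pebbles suffice. Then \<open>r\<close> is empty, its neighbours carry at most one
  pebble, and every vertex carries at most three. Vertices with at least two pebbles have
  pairwise distinct empty common neighbours with \<open>r\<close>. Fix a vertex \<open>u\<close> with three pebbles. The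
  other vertices with three pebbles are not adjacent to \<open>u\<close>, and their common neighbours with
  \<open>u\<close> are empty, pairwise distinct and not adjacent to \<open>r\<close>. There are thus so many empty
  vertices that the configuration has at most \<open>n\<close> pebbles.
\<close>

lemma config_size_fun_upd_le:
  assumes "finite (verts G)"
  shows "config_size G (C(v := m)) \<le> config_size G C + m"
proof -
  have "config_size G (C(v := m)) \<le> (\<Sum>x\<in>verts G. C x + (if x = v then m else 0))"
    unfolding config_size_def by (rule sum_mono) auto
  also have "\<dots> \<le> config_size G C + m"
    using assms by (simp add: sum.distrib config_size_def)
  finally show ?thesis .
qed

lemma config_size_zero [simp]: "config_size G (\<lambda>_. 0) = 0"
  by (simp add: config_size_def)

lemma solvable_zero: "solvable G 0 r C"
  unfolding solvable_def by blast

lemma solvable_if_root: "k \<le> C r \<Longrightarrow> solvable G k r C"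
  unfolding solvable_def by blast

lemma solvable_step:
  assumes "u \<rightarrow>\<^bsub>G\<^esub> v" "2 \<le> C u" "solvable G k r (C(u := C u - 2, v := C v + 1))"
  shows "solvable G k r C"
  using assms unfolding solvable_def
  by (meson converse_rtranclp_into_rtranclp pebbling_move.intros)

context loopfree_digraph
begin

text \<open>Idle pebbles never block a move. The guard \<open>2 \<le> C u\<close> keeps the
  natural-number subtraction exact, so taking two pebbles off \<open>u\<close> commutes with adding
  \<open>E u\<close>.\<close>

lemma pebbling_move_add:
  assumes "pebbling_move G C D"
  shows "pebbling_move G (\<lambda>x. C x + E x) (\<lambda>x. D x + E x)"
  using assms
proof cases
  case (1 u v)
  have "u \<noteq> v" using 1(2) adj_not_same by blast
  then have "(\<lambda>x. D x + E x) =
      (\<lambda>x. C x + E x)(u := (C u + E u) - 2, v := (C v + E v) + 1)"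
    using 1 by auto
  then show ?thesis
    using pebbling_move.intros[of u v G "\<lambda>x. C x + E x"] 1 by simp
qed

lemma pebbling_moves_add:
  assumes "(pebbling_move G)\<^sup>*\<^sup>* C D"
  shows "(pebbling_move G)\<^sup>*\<^sup>* (\<lambda>x. C x + E x) (\<lambda>x. D x + E x)"
  using assms
  by (induction rule: rtranclp_induct) (auto intro: rtranclp.rtrancl_into_rtrancl pebbling_move_add)

text \<open>Play the solution of \<open>C\<close> while \<open>D\<close> lies idle, then that of
  \<open>D\<close> while the outcome \<open>C'\<close> lies idle.\<close>

lemma solvable_add:
  assumes "solvable G j r C" "solvable G k r D"
  shows "solvable G (j + k) r (\<lambda>x. C x + D x)"
proof -
  obtain C' where C': "(pebbling_move G)\<^sup>*\<^sup>* C C'" "j \<le> C' r"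
    using assms(1) unfolding solvable_def by blast
  obtain D' where D': "(pebbling_move G)\<^sup>*\<^sup>* D D'" "k \<le> D' r"
    using assms(2) unfolding solvable_def by blast
  have "(pebbling_move G)\<^sup>*\<^sup>* (\<lambda>x. C x + D x) (\<lambda>x. C' x + D x)"
    using C'(1) by (rule pebbling_moves_add)
  also have "(pebbling_move G)\<^sup>*\<^sup>* (\<lambda>x. C' x + D x) (\<lambda>x. C' x + D' x)"
    using pebbling_moves_add[OF D'(1), of C'] by (simp add: add.commute)
  finally show ?thesis
    unfolding solvable_def using C'(2) D'(2) by (meson add_mono)
qed

end

text \<open>The combinatorial form of diameter at most two, free of walks and extended
  reals.\<close>

locale diameter_two_graph = Digraph.graph G for G :: "('a, 'b) pre_digraph" +
  assumes adjacent_or_common_neighbour: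
    "u \<in> verts G \<Longrightarrow> v \<in> verts G \<Longrightarrow> u \<noteq> v \<Longrightarrow>
      u \<rightarrow>\<^bsub>G\<^esub> v \<or> (\<exists>w. u \<rightarrow>\<^bsub>G\<^esub> w \<and> w \<rightarrow>\<^bsub>G\<^esub> v)"
begin

lemma adj_sym: "u \<rightarrow>\<^bsub>G\<^esub> v \<Longrightarrow> v \<rightarrow>\<^bsub>G\<^esub> u"
  using sym_arcs by (rule arcs_ends_symmetric)

lemma solvable_if_adj_two:
  assumes "v \<rightarrow>\<^bsub>G\<^esub> r" "2 \<le> C v"
  shows "solvable G 1 r C"
  using assms by (intro solvable_step[of v r G C] solvable_if_root) auto

text \<open>In the distant case, two moves from \<open>v\<close> put two pebbles on a common
  neighbour \<open>x\<close>, which pay for the move to \<open>r\<close>.\<close>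

lemma solvable_if_four:
  assumes "r \<in> verts G" "v \<in> verts G" "4 \<le> C v"
  shows "solvable G 1 r C"
proof -
  consider "v = r" | "v \<rightarrow>\<^bsub>G\<^esub> r" | x where "v \<rightarrow>\<^bsub>G\<^esub> x" "x \<rightarrow>\<^bsub>G\<^esub> r" "v \<noteq> x"
    using adjacent_or_common_neighbour[OF assms(2,1)] adj_not_same by blast
  then show ?thesis
  proof cases
    case 1 with assms show ?thesis by (intro solvable_if_root) simp
  next
    case 2 with assms show ?thesis by (intro solvable_if_adj_two) auto
  next
    case 3
    have "solvable G 1 r (C(v := C v - 2, x := C x + 1))"
      by (rule solvable_step[OF 3(1)], use 3 assms in simp)
         (rule solvable_if_adj_two[OF 3(2)], use 3 in simp)
    then show ?thesis using solvable_step[OF 3(1), of C] assms by simp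
  qed
qed

theorem cheap_solution:
  assumes r: "r \<in> verts G" and size: "card (verts G) < config_size G C"
  shows "\<exists>S. (\<forall>v. S v \<le> C v) \<and> config_size G S \<le> 7 \<and> solvable G 1 r S"
proof (rule ccontr)
  assume neg: "\<not> ?thesis"
  \<comment> \<open>Each structural fact below comes from an explicit cheap \<open>S\<close> that
    would fit inside \<open>C\<close> if the fact failed.\<close>
  have no: "solvable G 1 r S \<longrightarrow> config_size G S \<le> 7 \<longrightarrow> (\<exists>v. C v < S v)" for S
    using neg by (meson not_le)
  have upd: "config_size G (D(v := m)) \<le> config_size G D + m" for D v m
    by (rule config_size_fun_upd_le) simp
  let ?O = "\<lambda>_::'a. 0::nat"
  have s1: "config_size G (?O(u := a)) \<le> a" for u a
    using upd[of ?O u a] by simp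
  have s2: "config_size G (?O(u := a, v := b)) \<le> a + b" for u a v b
    using upd[of "?O(u := a)" v b] s1[of u a] by linarith
  have s3: "config_size G (?O(u := a, v := b, w := c)) \<le> a + b + c" for u a v b w c
    using upd[of "?O(u := a, v := b)" w c] s2[of u a v b] by linarith

  have Cr: "C r = 0"
  proof (rule ccontr)
    assume "C r \<noteq> 0"
    moreover have "solvable G 1 r (?O(r := 1))" by (rule solvable_if_root) simp
    ultimately show False using no[of "?O(r := 1)"] s1[of r 1] by (auto split: if_splits)
  qed
  have le3: "C v \<le> 3" if "v \<in> verts G" for v
  proof (rule ccontr)
    assume "\<not> C v \<le> 3"
    moreover have "solvable G 1 r (?O(v := 4))"
      by (rule solvable_if_four[OF r that]) simp
    ultimately show False using no[of "?O(v := 4)"] s1[of v 4] by (auto split: if_splits)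
  qed
  have nbr: "C v \<le> 1" if "v \<rightarrow>\<^bsub>G\<^esub> r" for v
  proof (rule ccontr)
    assume "\<not> C v \<le> 1"
    moreover have "solvable G 1 r (?O(v := 2))"
      by (rule solvable_if_adj_two[OF that]) simp
    ultimately show False using no[of "?O(v := 2)"] s1[of v 2] by (auto split: if_splits)
  qed
  \<comment> \<open>Otherwise \<open>u\<close> and \<open>v\<close> each send a pebble to
    \<open>x\<close>, and these two pay for one on \<open>r\<close>.\<close>
  have disj: "u = v" if "2 \<le> C u" "2 \<le> C v" "u \<rightarrow>\<^bsub>G\<^esub> x" "v \<rightarrow>\<^bsub>G\<^esub> x" "x \<rightarrow>\<^bsub>G\<^esub> r" for u v x
  proof (rule ccontr)
    assume "u \<noteq> v"
    moreover have "u \<noteq> x" "v \<noteq> x" using that adj_not_same by blast+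
    ultimately have "solvable G 1 r (?O(u := 2, v := 2))"
      by - (rule solvable_step[OF that(3)], simp,
          rule solvable_step[OF that(4)], simp, rule solvable_if_adj_two[OF that(5)], simp)
    then show False using no[of "?O(u := 2, v := 2)"] s2[of u 2 v 2] that by (auto split: if_splits)
  qed
  have empty: "C x = 0" if "2 \<le> C u" "u \<rightarrow>\<^bsub>G\<^esub> x" "x \<rightarrow>\<^bsub>G\<^esub> r" for u x
  proof (rule ccontr)
    assume *: "C x \<noteq> 0"
    have "u \<noteq> x" using that adj_not_same by blast
    then have "solvable G 1 r (?O(u := 2, x := 1))"
      by - (rule solvable_step[OF that(2)], simp,
          rule solvable_if_adj_two[OF that(3)], simp)
    then show False using no[of "?O(u := 2, x := 1)"] s2[of u 2 x 1] that * by (auto split: if_splits)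
  qed
  have nonadj: "\<not> u \<rightarrow>\<^bsub>G\<^esub> v" if "C u = 3" "C v = 3" for u v
  proof
    assume *: "u \<rightarrow>\<^bsub>G\<^esub> v"
    have "u \<noteq> v" "v \<in> verts G" using * adj_not_same by auto
    then have "solvable G 1 r (?O(u := 2, v := 3))"
      by - (rule solvable_step[OF *], simp, rule solvable_if_four[OF r, of v], simp, simp)
    then show False using no[of "?O(u := 2, v := 3)"] s2[of u 2 v 3] that by (auto split: if_splits)
  qed
  \<comment> \<open>A pebble on \<open>w\<close> and one sent from \<open>u\<close> would together
    deliver a fourth pebble to \<open>v\<close>.\<close>
  have empty3: "C w = 0"
    if "C u = 3" "C v = 3" "u \<noteq> v" "u \<rightarrow>\<^bsub>G\<^esub> w" "w \<rightarrow>\<^bsub>G\<^esub> v" for u v w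
  proof (rule ccontr)
    assume *: "C w \<noteq> 0"
    have "u \<noteq> w" "w \<noteq> v" "v \<in> verts G" using that adj_not_same by auto
    with that(3) have "solvable G 1 r (?O(u := 2, w := 1, v := 3))"
      by - (rule solvable_step[OF that(4)], simp,
          rule solvable_step[OF that(5)], simp, rule solvable_if_four[OF r, of v], simp, simp)
    then show False
      using no[of "?O(u := 2, w := 1, v := 3)"] s3[of u 2 w 1 v 3] that * by (auto split: if_splits)
  qed
  \<comment> \<open>Pebbles from \<open>u\<close> and \<open>u'\<close> meet on \<open>w\<close> and
    deliver a fourth one to \<open>v\<close>. This costs 2 + 2 + 3 pebbles, the most of all cases,
    and is the origin of the constant 7.\<close>
  have triple: False
    if "C u = 3" "C u' = 3" "C v = 3" "u \<noteq> u'" "u \<noteq> v" "u' \<noteq> v"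
      "u \<rightarrow>\<^bsub>G\<^esub> w" "u' \<rightarrow>\<^bsub>G\<^esub> w" "w \<rightarrow>\<^bsub>G\<^esub> v" for u u' v w
  proof -
    have "u \<noteq> w" "u' \<noteq> w" "w \<noteq> v" "v \<in> verts G" using that adj_not_same by auto
    with that(4-6) have "solvable G 1 r (?O(u := 2, u' := 2, v := 3))"
      by - (rule solvable_step[OF that(7)], simp, rule solvable_step[OF that(8)], simp,
          rule solvable_step[OF that(9)], simp, rule solvable_if_four[OF r, of v], simp, simp)
    then show False
      using no[of "?O(u := 2, u' := 2, v := 3)"] s3[of u 2 u' 2 v 3] that by (auto split: if_splits)
  qed

  define B where "B = {v \<in> verts G. 2 \<le> C v}"
  define T where "T = {v \<in> verts G. C v = 3}"
  define Z where "Z = {v \<in> verts G. v \<noteq> r \<and> C v = 0}"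
  have fin: "finite B" "finite T" "finite Z" by (auto simp: B_def T_def Z_def)
  \<comment> \<open>For c at most 3, c + [c = 0] = 1 + [c \<ge> 2] + [c = 3]; sum this over the
    vertices. The empty root is kept out of \<open>Z\<close> and gives the separate 1 on the
    left.\<close>
  have count: "config_size G C + card Z + 1 = card (verts G) + card B + card T"
  proof -
    have ind: "(\<Sum>v\<in>verts G. of_bool (P v)) = card {v \<in> verts G. P v}" for P
      by (simp add: sum.If_cases of_bool_def Int_def)
    have "(\<Sum>v\<in>verts G. C v + of_bool (v \<noteq> r \<and> C v = 0) + of_bool (v = r)) =
          (\<Sum>v\<in>verts G. 1 + of_bool (2 \<le> C v) + of_bool (C v = 3))"
    proof (rule sum.cong[OF refl])
      fix v assume "v \<in> verts G"
      then have "C v = 0 \<or> C v = 1 \<or> C v = 2 \<or> C v = 3" using le3[of v] by linarith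
      then show "C v + of_bool (v \<noteq> r \<and> C v = 0) + of_bool (v = r) =
          1 + of_bool (2 \<le> C v) + of_bool (C v = 3)"
        using Cr by auto
    qed
    moreover have "{v \<in> verts G. v = r} = {r}" using r by auto
    ultimately show ?thesis
      by (simp only: sum.distrib ind) (simp add: config_size_def B_def T_def Z_def)
  qed

  \<comment> \<open>With two pebbles, \<open>v\<close> is neither \<open>r\<close> nor a neighbour
    of \<open>r\<close>.\<close>
  have "\<exists>x. v \<rightarrow>\<^bsub>G\<^esub> x \<and> x \<rightarrow>\<^bsub>G\<^esub> r" if "v \<in> B" for v
    using that adjacent_or_common_neighbour[of v r] r nbr[of v] Cr by (force simp: B_def)
  then obtain f where f: "\<And>v. v \<in> B \<Longrightarrow> v \<rightarrow>\<^bsub>G\<^esub> f v \<and> f v \<rightarrow>\<^bsub>G\<^esub> r" by metis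
  have f_inj: "inj_on f B"
    by (rule inj_onI) (metis (mono_tags, lifting) B_def disj f mem_Collect_eq)
  have f_Z: "f ` B \<subseteq> Z"
  proof
    fix x assume "x \<in> f ` B"
    then obtain v where v: "v \<in> B" "x = f v" by blast
    then have x: "v \<rightarrow>\<^bsub>G\<^esub> x" "x \<rightarrow>\<^bsub>G\<^esub> r" using f by auto
    then have "C x = 0" using empty[of v x] v by (simp add: B_def)
    then show "x \<in> Z" using x adj_not_same by (auto simp: Z_def)
  qed

  have "card B \<le> card Z"
    using card_inj_on_le[OF f_inj f_Z fin(3)] .
  \<comment> \<open>If \<open>T\<close> were empty, \<open>count\<close> would leave fewer pebbles
    than vertices.\<close>
  then have "T \<noteq> {}" using count size by auto
  then obtain u where u: "u \<in> T" by blast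
  have "\<exists>w. u \<rightarrow>\<^bsub>G\<^esub> w \<and> w \<rightarrow>\<^bsub>G\<^esub> v" if "v \<in> T - {u}" for v
    using that u adjacent_or_common_neighbour[of u v] nonadj[of u v] by (auto simp: T_def)
  then obtain g where g: "\<And>v. v \<in> T - {u} \<Longrightarrow> u \<rightarrow>\<^bsub>G\<^esub> g v \<and> g v \<rightarrow>\<^bsub>G\<^esub> v" by metis
  have g_inj: "inj_on g (T - {u})"
  proof (rule inj_onI, rule ccontr)
    fix v v' assume *: "v \<in> T - {u}" "v' \<in> T - {u}" "g v = g v'" "v \<noteq> v'"
    then show False
      using triple[of u v' v "g v"] g[of v] g[of v'] u adj_sym[of "g v'" v'] by (auto simp: T_def)
  qed
  \<comment> \<open>Otherwise \<open>u\<close> and \<open>v\<close> would share a neighbour adjacent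
    to \<open>r\<close>, against \<open>disj\<close>. This separates the images of \<open>f\<close>
    and \<open>g\<close>.\<close>
  have g_nonadj: "\<not> g v \<rightarrow>\<^bsub>G\<^esub> r" if "v \<in> T - {u}" for v
    using disj[of u v "g v"] g[OF that] u that adj_sym[of "g v" v] by (auto simp: T_def)
  have g_Z: "g ` (T - {u}) \<subseteq> Z"
  proof
    fix w assume "w \<in> g ` (T - {u})"
    then obtain v where v: "v \<in> T - {u}" "w = g v" by blast
    have "C w = 0" using empty3[of u v w] g[OF v(1)] v u by (auto simp: T_def)
    \<comment> \<open>If \<open>w\<close> were \<open>r\<close>, then \<open>u\<close> would be a
      neighbour of the root with three pebbles.\<close>
    moreover have "w \<noteq> r" using g[OF v(1)] v(2) nbr[of u] u by (auto simp: T_def)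
    ultimately show "w \<in> Z" using g[OF v(1)] v(2) adj_in_verts(1)[of w v] by (auto simp: Z_def)
  qed
  have "\<forall>x \<in> f ` B. x \<rightarrow>\<^bsub>G\<^esub> r" using f by simp
  moreover have "\<forall>x \<in> g ` (T - {u}). \<not> x \<rightarrow>\<^bsub>G\<^esub> r" using g_nonadj by simp
  ultimately have "f ` B \<inter> g ` (T - {u}) = {}" by blast
  then have "card (f ` B \<union> g ` (T - {u})) = card B + (card T - 1)"
    using fin u by (simp add: card_Un_disjoint card_image f_inj g_inj)
  moreover have "card (f ` B \<union> g ` (T - {u})) \<le> card Z"
    using f_Z g_Z fin by (intro card_mono) auto
  \<comment> \<open>Now \<open>card Z\<close> is at least \<open>card B + card T - 1\<close>, so
    \<open>count\<close> leaves at most \<open>card (verts G)\<close> pebbles.\<close>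
  ultimately show False using count size by linarith
qed

text \<open>For positive \<open>k\<close> the hypothesis leaves more pebbles than vertices, so
  \<open>cheap_solution\<close> applies. Removing its at most seven pebbles preserves the hypothesis
  for \<open>k - 1\<close>. The 6 stands on the right to avoid truncated subtraction.\<close>

theorem solvable_if_large:
  assumes "r \<in> verts G" "card (verts G) + 7 * k \<le> config_size G C + 6"
  shows "solvable G k r C"
  using assms(2)
proof (induction k arbitrary: C)
  case 0
  show ?case by (rule solvable_zero)
next
  case (Suc k)
  then obtain S where S: "\<And>v. S v \<le> C v" "config_size G S \<le> 7" "solvable G 1 r S"
    using cheap_solution[OF assms(1), of C] by auto
  have "config_size G C = config_size G S + config_size G (\<lambda>v. C v - S v)"
    unfolding config_size_def using S(1) by (simp flip: sum.distrib)
  then have "solvable G k r (\<lambda>v. C v - S v)"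
    using Suc S(2) by simp
  then show ?case using solvable_add[OF S(3), of k "\<lambda>v. C v - S v"] S(1) by simp
qed

end

lemma (in wf_digraph) adjacent_or_common_neighbour_if_distance_le_two:
  assumes "graph_distance G u v \<le> 2" "u \<noteq> v"
  shows "u \<rightarrow>\<^bsub>G\<^esub> v \<or> (\<exists>w. u \<rightarrow>\<^bsub>G\<^esub> w \<and> w \<rightarrow>\<^bsub>G\<^esub> v)"
proof -
  \<comment> \<open>A strict bound on the infimum yields an actual walk of cost below 3, hence of at
    most two arcs.\<close>
  have "\<mu> (\<lambda>_. 1) u v < 3"
    using assms(1) unfolding graph_distance_def by (rule le_less_trans) simp
  then obtain p where p: "awalk u p v" "ereal (awalk_cost (\<lambda>_. 1) p) < 3"
    unfolding \<mu>_def by (auto simp: INF_less_iff)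
  have "awalk_cost (\<lambda>_. 1) p = real (length p)"
    by (induction p) (auto simp: awalk_cost_def)
  with p(2) have "length p < 3" by simp
  then consider "p = []" | a where "p = [a]" | a b where "p = [a, b]"
    by (cases p rule: list.exhaust; cases "tl p"; cases "tl (tl p)") auto
  then show ?thesis
    proof cases
    case 1
    with p(1) assms(2) show ?thesis by (simp add: awalk_simps)
  next
    case 2
    with p(1) show ?thesis by (auto simp: awalk_simps dest: in_arcs_imp_in_arcs_ends)
  next
    case 3
    with p(1) have "u \<rightarrow>\<^bsub>G\<^esub> head G a" "head G a \<rightarrow>\<^bsub>G\<^esub> v"
      by (auto simp: awalk_simps dest: in_arcs_imp_in_arcs_ends)
    then show ?thesis by blast
  qed
qed

theorem theorem3:
  fixes G :: "('a, 'b) pre_digraph" and n k :: nat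
  assumes "Digraph.graph G"
    and "Digraph_Component.connected G"
    and "card (verts G) = n"
    and "graph_diameter G \<le> 2"
    and "1 \<le> k"
  shows "pebbling_number G k \<le> n + 7 * k - 6"
proof -
  interpret Digraph.graph G by fact
  have "graph_distance G u v \<le> 2" if "u \<in> verts G" "v \<in> verts G" for u v
    using assms(4) that unfolding graph_diameter_def by (auto simp: SUP_le_iff)
  then interpret diameter_two_graph G
    by unfold_locales (rule adjacent_or_common_neighbour_if_distance_le_two)
  have nonempty: "verts G \<noteq> {}"
    using assms(2) by (auto simp: connected_def strongly_connected_def)
  then have "0 < n" using assms(3) by (auto simp: card_gt_0_iff)
  \<comment> \<open>The bound satisfies the condition under \<open>LEAST\<close>; since
    \<open>1 \<le> k\<close>, it is positive and its subtraction is not truncated.\<close>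
  then have "rooted_pebbling_number G k r \<le> n + 7 * k - 6" if "r \<in> verts G" for r
    unfolding rooted_pebbling_number_def
    using solvable_if_large[OF that, of k] assms(3,5) by (intro Least_le) auto
  then show ?thesis
    unfolding pebbling_number_def using nonempty by (subst Max_le_iff) auto
qed

end
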